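(* Let $n\ge 2$. For all real $\lambda\ge 0$, \[L_{\mathbb{R}}(\triangle_{n+1}-\boldsymbol{\tau}_{n+1};\lambda)=\sum_{k=0}^{\lfloor n\lambda\rfloor}L_{\mathbb{R}}\left(\triangle_n-\boldsymbol{\tau}_n;\frac{k}{n}\right),\] that is, $\left|\lambda(\triangle_{n+1}-\boldsymbol{\tau}_{n+1})\cap\mathbb{Z}^{n+1}\right|=\sum_{k=0}^{\lfloor n\lambda\rfloor}\left|\frac{k}{n}(\triangle_n-\boldsymbol{\tau}_n)\cap\mathbb{Z}^n\right|$.
   Context: Stack-sorting: for a finite sequence $\boldsymbol{\pi}=\pi_1\pi_2\cdots\pi_m$ of distinct elements of a totally ordered set, the output $s(\boldsymbol{\pi})$ is obtained as follows. Start with an empty stack (last-in, first-out) and an empty output. For $i=1,\dots,m$ in order: while the stack is nonempty and $\pi_i$ is greater than the top element of the stack, pop the top element and append it to the end of the output; then push $\pi_i$ onto the stack. After all entries have been pushed, pop all remaining elements from top to bottom, appending each to the output. Write $s^0(\boldsymbol{\pi})=\boldsymbol{\pi}$ and $s^{i}(\boldsymbol{\pi})=s(s^{i-1}(\boldsymbol{\pi}))$. For a permutation $\boldsymbol{\pi}$ of $\{1,\dots,m\}$, iterating $s$ eventually reaches the identity (fixed by $s$), and $\mathcal{S}^{\boldsymbol{\pi}}:=\{s^0(\boldsymbol{\pi}),s^1(\boldsymbol{\pi}),\dots\}$ is the finite set of all iterates until the identity is reached. Permutations $\pi_1\cdots\pi_m$ in one-line notation are identified with points $(\pi_1,\dots,\pi_m)\in\mathbb{R}^m$.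 For each $m\ge2$, $\boldsymbol{\tau}_m:=23\cdots m1=(2,3,\dots,m,1)$ and $\triangle_m:=\operatorname{conv}(\mathcal{S}^{\boldsymbol{\tau}_m})\subset\mathbb{R}^m$. For a set $S$ and a point $\mathbf{v}$, $S-\mathbf{v}=\{\mathbf{x}-\mathbf{v}:\mathbf{x}\in S\}$. For a convex polytope $P\subset\mathbb{R}^m$ and real $\lambda\ge0$, $L_{\mathbb{R}}(P;\lambda):=|\lambda P\cap\mathbb{Z}^m|$ with $\lambda P=\{\lambda\mathbf{x}:\mathbf{x}\in P\}$. *)

theory Defs
  imports "HOL-Analysis.Analysis" "HOL-Library.Function_Algebras"
begin

text \<open>
  The dimension varies inside the statement, so a point of \<open>\<real>\<^sup>m\<close> is a function
  \<open>nat \<Rightarrow> real\<close> vanishing outside \<open>{1..m}\<close>. The pointwise vector space structure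
  makes the library's \<open>convex hull\<close> applicable; addition comes from
  HOL-Library.Function_Algebras, and only scalar multiplication is missing.
\<close>

instantiation "fun" :: (type, scaleR) scaleR
begin

definition scaleR_fun :: "real \<Rightarrow> ('a \<Rightarrow> 'b) \<Rightarrow> 'a \<Rightarrow> 'b" where
  "scaleR_fun c f = (\<lambda>i. c *\<^sub>R f i)"

instance ..

end

instance "fun" :: (type, real_vector) real_vector
  by standard (simp_all add: fun_eq_iff scaleR_fun_def scaleR_add_right scaleR_add_left)

text \<open>
  The arguments of \<open>stack_sort_run\<close> are the remaining input, the stack (top first) and
  the output produced so far.
\<close>

fun stack_sort_run :: "'a::linorder list \<Rightarrow> 'a list \<Rightarrow> 'a list \<Rightarrow> 'a list" where
  "stack_sort_run [] st out = out @ st"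
| "stack_sort_run (x # xs) [] out = stack_sort_run xs [x] out"
| "stack_sort_run (x # xs) (t # st) out =
     (if x > t then stack_sort_run (x # xs) st (out @ [t])
      else stack_sort_run xs (x # t # st) out)"

definition stack_sort :: "'a::linorder list \<Rightarrow> 'a list" where
  "stack_sort p = stack_sort_run p [] []"

text \<open>
  The identity is a fixed point of \<open>stack_sort\<close>, so taking all iterates
  adds nothing to the iterates up to the first occurrence of the identity.
\<close>

definition stack_sort_iterates :: "'a::linorder list \<Rightarrow> 'a list set" where
  "stack_sort_iterates p = range (\<lambda>i. (stack_sort ^^ i) p)"

definition point_of :: "nat list \<Rightarrow> nat \<Rightarrow> real" where
  "point_of p = (\<lambda>i. if i \<in> {1..length p} then real (p ! (i - 1)) else 0)"

definition tau :: "nat \<Rightarrow> nat list" where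
  "tau m = [2..<m + 1] @ [1]"

definition stack_triangle :: "nat \<Rightarrow> (nat \<Rightarrow> real) set" where
  "stack_triangle m = convex hull (point_of ` stack_sort_iterates (tau m))"

definition translate_neg :: "(nat \<Rightarrow> real) set \<Rightarrow> (nat \<Rightarrow> real) \<Rightarrow> (nat \<Rightarrow> real) set" where
  "translate_neg S v = (\<lambda>x. x - v) ` S"

definition int_points :: "nat \<Rightarrow> (nat \<Rightarrow> real) set" where
  "int_points m = {x. (\<forall>i\<in>{1..m}. x i \<in> \<int>) \<and> (\<forall>i. i \<notin> {1..m} \<longrightarrow> x i = 0)}"

definition L_real :: "nat \<Rightarrow> (nat \<Rightarrow> real) set \<Rightarrow> real \<Rightarrow> nat" where
  "L_real m P lam = card ((\<lambda>x. lam *\<^sub>R x) ` P \<inter> int_points m)"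

end

theory Submission
  imports Defs
begin

text \<open>
  Sorting \<open>2 3 \<dots> m 1\<close> moves the entry \<open>1\<close> one place to the left in each step and leaves the
  order of the other entries alone, so the orbit consists of the \<open>m\<close> permutations
  \<open>2 \<dots> k 1 (k+1) \<dots> m\<close>. After translation by \<open>\<tau>\<^sub>m\<close>, write a point \<open>x\<close> as
  \<open>x\<^sub>i = y\<^sub>i\<^sub>-\<^sub>1 - y\<^sub>i\<close> with \<open>y\<^sub>0 = 0\<close>, that is, let \<open>-y\<^sub>i\<close> be its partial sums. This change of
  coordinates is linear and preserves integrality in both directions. The vertex with \<open>1\<close> at
  position \<open>k\<close> becomes \<open>(0, \<dots>, 0, k, k+1, \<dots>, m-1)\<close>, and the convex hull of these points is
  the lecture hall simplex \<open>0 \<le> y\<^sub>1/1 \<le> y\<^sub>2/2 \<le> \<dots> \<le> y\<^sub>m\<^sub>-\<^sub>1/(m-1) \<le> 1\<close>: the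
  barycentric coordinates of \<open>y\<close> are the successive differences of the ratios \<open>y\<^sub>i/i\<close>.
  Dilation by \<open>\<lambda>\<close> just replaces the last bound by \<open>\<lambda>\<close>
  (\<open>L_real_stack_triangle\<close>).

  The recurrence is now the slicing by the last coordinate. For \<open>m = n + 1\<close>, an integer point of
  the \<open>\<lambda>\<close>-dilate has \<open>y\<^sub>n = k\<close> with \<open>0 \<le> k \<le> n\<lambda>\<close>, and the remaining coordinates satisfy
  exactly the inequalities of the lecture hall simplex of one dimension less with the bound
  \<open>k/n\<close> (\<open>card_lecture_hall_points_Suc\<close>).
\<close>

section \<open>The orbit of the permutation under stack-sorting\<close>

definition one_at :: "nat \<Rightarrow> nat \<Rightarrow> nat list" where
  "one_at m k = [2..<k + 1] @ 1 # [k + 1..<m + 1]"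

lemma tau_eq_one_at: "tau m = one_at m m"
  by (simp add: tau_def one_at_def)

text \<open>
  Each new entry exceeds the single one on the stack, so it sends that entry to the output and
  takes its place.
\<close>

lemma stack_sort_run_ascending:
  assumes "sorted_wrt (<) (t # xs)"
  shows "stack_sort_run (xs @ zs) [t] out =
    stack_sort_run zs [last (t # xs)] (out @ butlast (t # xs))"
  using assms by (induction xs arbitrary: t out) auto

lemma stack_sort_ascending:
  assumes "sorted_wrt (<) xs"
  shows "stack_sort xs = xs"
proof (cases xs)
  case (Cons t ts)
  have "stack_sort xs = stack_sort_run (ts @ []) [t] []"
    using Cons by (simp add: stack_sort_def)
  also have "\<dots> = xs"
    by (subst stack_sort_run_ascending)
      (use assms in \<open>simp_all only: Cons stack_sort_run.simps append_Nil append_butlast_last_id list.distinct not_False_eq_True\<close>)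
  finally show ?thesis .
qed (simp add: stack_sort_def)

text \<open>
  The state reached once the entry \<open>1\<close> of an iterate has been pushed onto the maximum of the
  entries to its left: the next entry clears the stack, and the rest passes straight through.
\<close>

lemma stack_sort_run_two:
  assumes "sorted_wrt (<) (a # b # ys)"
  shows "stack_sort_run ys [a, b] out = out @ a # b # ys"
proof (cases ys)
  case (Cons y zs)
  have "stack_sort_run ys [a, b] out = stack_sort_run (zs @ []) [y] (out @ [a, b])"
    using Cons assms by simp
  also have "\<dots> = out @ a # b # ys"
    by (subst stack_sort_run_ascending)
      (use assms Cons in \<open>simp_all del: butlast.simps last.simps\<close>)
  finally show ?thesis .
qed simp

text \<open>
  The ascending run before the \<open>1\<close> leaves only its maximum \<open>k + 1\<close> on the stack. The \<open>1\<close> lands on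
  top of it and is popped first, so these two entries change places.
\<close>

lemma stack_sort_one_at_Suc:
  assumes "1 \<le> k" "Suc k \<le> m"
  shows "stack_sort (one_at m (Suc k)) = one_at m k"
proof -
  let ?zs = "1 # [k + 2..<m + 1]"
  have up: "2 # [3..<k + 2] = [2..<k + 2]"
    using assms upt_conv_Cons[of 2 "k + 2"] by simp
  have upto: "[2..<k + 2] = [2..<k + 1] @ [k + 1]"
    using assms by simp
  have "Suc k + 1 = k + 2" by simp
  then have "one_at m (Suc k) = 2 # [3..<k + 2] @ ?zs"
    by (simp only: one_at_def up flip: append_Cons)
  then have "stack_sort (one_at m (Suc k)) = stack_sort_run ([3..<k + 2] @ ?zs) [2] []"
    by (simp only: stack_sort_def stack_sort_run.simps)
  also have "\<dots> = stack_sort_run ?zs [last [2..<k + 2]] ([] @ butlast [2..<k + 2])"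
    using stack_sort_run_ascending[of 2 "[3..<k + 2]" ?zs "[]"]
    by (simp only: up sorted_wrt_upt)
  also have "\<dots> = stack_sort_run ?zs [k + 1] [2..<k + 1]"
    by (simp only: upto last_snoc butlast_snoc append_Nil)
  also have "\<dots> = stack_sort_run [k + 2..<m + 1] [1, k + 1] [2..<k + 1]"
    using assms by simp
  also have "\<dots> = [2..<k + 1] @ 1 # (k + 1) # [k + 2..<m + 1]"
    using assms by (subst stack_sort_run_two) (auto simp del: upt_Suc)
  also have "\<dots> = one_at m k"
    using assms upt_conv_Cons[of "k + 1" "m + 1"] by (simp add: one_at_def)
  finally show ?thesis .
qed

lemma stack_sort_one_at_1: "stack_sort (one_at m 1) = one_at m 1"
  by (rule stack_sort_ascending) (auto simp: one_at_def simp del: upt_Suc)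

lemma stack_sort_funpow_tau:
  assumes "1 \<le> m"
  shows "(stack_sort ^^ i) (tau m) = one_at m (max 1 (m - i))"
proof (induction i)
  case 0
  then show ?case using assms by (simp add: tau_eq_one_at max_absorb2)
next
  case (Suc i)
  show ?case
  proof (cases "m - i \<le> 1")
    case True
    then have "max 1 (m - i) = 1" "max 1 (m - Suc i) = 1"
      by auto
    then show ?thesis using Suc stack_sort_one_at_1[of m] by simp
  next
    case False
    then have "max 1 (m - i) = Suc (max 1 (m - Suc i))" "Suc (max 1 (m - Suc i)) \<le> m"
      by auto
    then show ?thesis using Suc stack_sort_one_at_Suc[of "max 1 (m - Suc i)" m] by simp
  qed
qed

lemma stack_sort_iterates_tau:
  assumes "1 \<le> m"
  shows "stack_sort_iterates (tau m) = one_at m ` {1..m}"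
proof -
  have "range (\<lambda>i. max 1 (m - i)) = {1..m}"
  proof (intro equalityI subsetI)
    fix k assume "k \<in> {1..m}"
    then have "k = max 1 (m - (m - k))" by auto
    then show "k \<in> range (\<lambda>i. max 1 (m - i))" by blast
  qed (use assms in auto)
  then have "one_at m ` {1..m} = range (\<lambda>i. one_at m (max 1 (m - i)))"
    by (metis image_image)
  then show ?thesis
    by (simp add: stack_sort_iterates_def stack_sort_funpow_tau[OF assms])
qed

lemma point_of_one_at:
  assumes "1 \<le> k" "k \<le> m"
  shows "point_of (one_at m k) i =
    (if i = 0 \<or> i > m then 0 else if i < k then real i + 1 else if i = k then 1 else real i)"
proof -
  have "length (one_at m k) = m"
    using assms by (simp add: one_at_def del: upt_Suc)
  then show ?thesis
    using assms by (auto simp: point_of_def one_at_def nth_append nth_Cons' simp del: upt_Suc)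
qed

section \<open>The lecture hall simplex\<close>

text \<open>
  As \<open>y 0 / 0 = 0\<close>, the case \<open>i = 0\<close> of the chain says \<open>0 \<le> y 1\<close>; for \<open>d = 0\<close> the last condition
  reads \<open>0 \<le> lam\<close>.
\<close>

definition lecture_hall_simplex :: "nat \<Rightarrow> real \<Rightarrow> (nat \<Rightarrow> real) set" where
  "lecture_hall_simplex d lam = {y. (\<forall>i. i \<notin> {1..d} \<longrightarrow> y i = 0) \<and>
     (\<forall>i<d. y i / real i \<le> y (Suc i) / real (Suc i)) \<and> y d / real d \<le> lam}"

definition lecture_hall_vertex :: "nat \<Rightarrow> nat \<Rightarrow> nat \<Rightarrow> real" where
  "lecture_hall_vertex d k = (\<lambda>j. if k \<le> j \<and> j \<le> d then real j else 0)"

lemma sum_fun_apply: "(\<Sum>k\<in>A. f k) x = (\<Sum>k\<in>A. f k x)"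
  by (induction A rule: infinite_finite_induct) auto

lemma lecture_hall_ratio_mono:
  assumes y: "y \<in> lecture_hall_simplex d lam" and "i \<le> j" "j \<le> d"
  shows "y i / real i \<le> y j / real j"
  using assms(2,3)
proof (induction j rule: dec_induct)
  case (step j)
  then have "y i / real i \<le> y j / real j" by simp
  also have "\<dots> \<le> y (Suc j) / real (Suc j)"
    using y step by (simp add: lecture_hall_simplex_def)
  finally show ?case .
qed simp

lemma lecture_hall_nonneg:
  assumes y: "y \<in> lecture_hall_simplex d lam"
  shows "0 \<le> y j"
proof (cases "1 \<le> j \<and> j \<le> d")
  case True
  then have "0 \<le> y j / real j"
    using lecture_hall_ratio_mono[OF y, of 0 j] by simp
  then show ?thesis using True by (simp add: zero_le_divide_iff)
next
  case False
  then have "y j = 0"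
    using y by (auto simp: lecture_hall_simplex_def)
  then show ?thesis by simp
qed

lemma convex_lecture_hall_simplex: "convex (lecture_hall_simplex d lam)"
proof (rule convexI)
  fix x y :: "nat \<Rightarrow> real" and u v :: real
  assume x: "x \<in> lecture_hall_simplex d lam" and y: "y \<in> lecture_hall_simplex d lam"
    and uv: "0 \<le> u" "0 \<le> v" "u + v = 1"
  have ratio: "(u *\<^sub>R x + v *\<^sub>R y) i / r = u * (x i / r) + v * (y i / r)" for i r
    by (simp add: scaleR_fun_def add_divide_distrib)
  have "u * (x d / real d) + v * (y d / real d) \<le> u * lam + v * lam"
    using x y uv by (intro add_mono mult_left_mono) (auto simp: lecture_hall_simplex_def)
  also have "\<dots> = lam"
    using uv by (simp flip: distrib_right)
  finally have "(u *\<^sub>R x + v *\<^sub>R y) d / real d \<le> lam"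
    by (simp only: ratio)
  moreover have "(u *\<^sub>R x + v *\<^sub>R y) i / real i \<le> (u *\<^sub>R x + v *\<^sub>R y) (Suc i) / real (Suc i)"
    if "i < d" for i
    unfolding ratio using x y uv that
    by (intro add_mono mult_left_mono) (auto simp: lecture_hall_simplex_def)
  ultimately show "u *\<^sub>R x + v *\<^sub>R y \<in> lecture_hall_simplex d lam"
    using x y by (auto simp: lecture_hall_simplex_def scaleR_fun_def)
qed

lemma lecture_hall_vertex_mem:
  assumes "1 \<le> k"
  shows "lecture_hall_vertex d k \<in> lecture_hall_simplex d 1"
  using assms by (auto simp: lecture_hall_simplex_def lecture_hall_vertex_def)

text \<open>
  Every ratio \<open>y j / j\<close> of the \<open>k\<close>-th vertex is \<open>0\<close> for \<open>j < k\<close> and \<open>1\<close> from \<open>k\<close> on. The coefficient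
  of this vertex in \<open>y\<close> is therefore the jump of the ratios of \<open>y\<close> at \<open>k\<close>; the origin, which is the
  vertex for \<open>k = d + 1\<close>, receives what is missing to \<open>1\<close>.
\<close>

lemma lecture_hall_simplex_eq_hull:
  "lecture_hall_simplex d 1 = convex hull (lecture_hall_vertex d ` {1..Suc d})"
proof (intro equalityI subsetI)
  fix y assume y: "y \<in> lecture_hall_simplex d 1"
  \<comment> \<open>The value \<open>1\<close> beyond \<open>d\<close> makes the last jump the coefficient of the origin.\<close>
  define A where "A j = (if j \<le> d then y j / real j else 1)" for j
  have A_le: "A j \<le> A (Suc j)" if "j \<le> d" for j
    using y that lecture_hall_ratio_mono[OF y, of j "Suc j"]
    by (cases "j = d") (auto simp: A_def lecture_hall_simplex_def)
  have telescope: "(\<Sum>k=1..j. A k - A (k - 1)) = A j" for j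
  proof (induction j)
    case 0
    then show ?case by (simp add: A_def)
  qed simp
  have sum_one: "(\<Sum>k=1..Suc d. A k - A (k - 1)) = 1"
    by (subst telescope) (simp add: A_def)
  have "y = (\<Sum>k=1..Suc d. (A k - A (k - 1)) *\<^sub>R lecture_hall_vertex d k)"
  proof
    fix j
    show "y j = (\<Sum>k=1..Suc d. (A k - A (k - 1)) *\<^sub>R lecture_hall_vertex d k) j"
    proof (cases "1 \<le> j \<and> j \<le> d")
      case True
      have "(\<Sum>k=1..Suc d. (A k - A (k - 1)) *\<^sub>R lecture_hall_vertex d k) j
          = (\<Sum>k=1..Suc d. if k \<le> j then (A k - A (k - 1)) * real j else 0)"
        using True by (simp only: sum_fun_apply scaleR_fun_def)
          (intro sum.cong refl, auto simp: lecture_hall_vertex_def)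
      also have "\<dots> = (\<Sum>k\<in>{1..j}. (A k - A (k - 1)) * real j)"
        using True by (intro sum.mono_neutral_cong_right) auto
      also have "\<dots> = A j * real j"
        by (simp only: telescope flip: sum_distrib_right)
      also have "\<dots> = y j"
        using True by (simp add: A_def)
      finally show ?thesis by simp
    next
      case False
      have "y j = 0"
        using False y by (auto simp: lecture_hall_simplex_def)
      moreover have "(\<Sum>k=1..Suc d. (A k - A (k - 1)) *\<^sub>R lecture_hall_vertex d k) j = 0"
        using False by (simp only: sum_fun_apply scaleR_fun_def)
          (intro sum.neutral, auto simp: lecture_hall_vertex_def)
      ultimately show ?thesis by simp
    qed
  qed
  also have "\<dots> \<in> convex hull (lecture_hall_vertex d ` {1..Suc d})"
  proof (rule convex_sum[OF _ convex_convex_hull sum_one])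
    fix k assume "k \<in> {1..Suc d}"
    then show "0 \<le> A k - A (k - 1)"
      using A_le[of "k - 1"] by auto
  qed (auto intro: hull_inc)
  finally show "y \<in> convex hull (lecture_hall_vertex d ` {1..Suc d})" .
next
  fix y assume "y \<in> convex hull (lecture_hall_vertex d ` {1..Suc d})"
  moreover have "convex hull (lecture_hall_vertex d ` {1..Suc d}) \<subseteq> lecture_hall_simplex d 1"
    by (rule hull_minimal) (use lecture_hall_vertex_mem convex_lecture_hall_simplex in auto)
  ultimately show "y \<in> lecture_hall_simplex d 1" by blast
qed

text \<open>
  Rescaling by \<open>inverse lam\<close> is impossible for \<open>lam = 0\<close>, so this dilate needs its own argument: all
  ratios lie between \<open>0\<close> and \<open>0\<close>.
\<close>

lemma lecture_hall_simplex_0: "lecture_hall_simplex d 0 = {0}"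
proof -
  have "y = 0" if y: "y \<in> lecture_hall_simplex d 0" for y
  proof
    fix j
    have "y j \<le> 0"
    proof (cases "1 \<le> j \<and> j \<le> d")
      case True
      then have "y j / real j \<le> 0"
        using lecture_hall_ratio_mono[OF y, of j d] y by (auto simp: lecture_hall_simplex_def)
      then show ?thesis using True by (simp add: divide_le_0_iff)
    qed (use y in \<open>auto simp: lecture_hall_simplex_def\<close>)
    then show "y j = 0 j"
      using lecture_hall_nonneg[OF y, of j] by simp
  qed
  then show ?thesis by (auto simp: lecture_hall_simplex_def)
qed

lemma scaleR_lecture_hall_simplex:
  assumes "0 \<le> c" "y \<in> lecture_hall_simplex d lam"
  shows "c *\<^sub>R y \<in> lecture_hall_simplex d (c * lam)"
proof -
  have ratio: "(c *\<^sub>R y) i / r = c * (y i / r)" for i r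
    by (simp add: scaleR_fun_def)
  have "c * (y i / real i) \<le> c * (y (Suc i) / real (Suc i))" if "i < d" for i
    using assms that by (intro mult_left_mono) (auto simp: lecture_hall_simplex_def)
  moreover have "c * (y d / real d) \<le> c * lam"
    using assms by (intro mult_left_mono) (auto simp: lecture_hall_simplex_def)
  moreover have "(c *\<^sub>R y) i = 0" if "i \<notin> {1..d}" for i
    using assms(2) that by (simp add: lecture_hall_simplex_def scaleR_fun_def)
  ultimately show ?thesis
    unfolding lecture_hall_simplex_def mem_Collect_eq ratio by blast
qed

lemma lecture_hall_simplex_scale:
  assumes "0 \<le> lam"
  shows "(\<lambda>y. lam *\<^sub>R y) ` lecture_hall_simplex d 1 = lecture_hall_simplex d lam"
proof (cases "lam = 0")
  case True
  have "lecture_hall_vertex d 1 \<in> lecture_hall_simplex d 1"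
    by (rule lecture_hall_vertex_mem) simp
  then show ?thesis
    by (auto simp: True lecture_hall_simplex_0)
next
  case False
  show ?thesis
  proof (intro equalityI subsetI)
    fix y assume "y \<in> lecture_hall_simplex d lam"
    then have "inverse lam *\<^sub>R y \<in> lecture_hall_simplex d 1"
      using scaleR_lecture_hall_simplex[of "inverse lam" y d lam] assms False by simp
    moreover have "y = lam *\<^sub>R (inverse lam *\<^sub>R y)"
      using False by simp
    ultimately show "y \<in> (\<lambda>y. lam *\<^sub>R y) ` lecture_hall_simplex d 1"
      by blast
  next
    fix x assume "x \<in> (\<lambda>y. lam *\<^sub>R y) ` lecture_hall_simplex d 1"
    then show "x \<in> lecture_hall_simplex d lam"
      using scaleR_lecture_hall_simplex[OF assms, of _ d 1] by auto
  qed
qed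

section \<open>Unimodular equivalence of the two simplices\<close>

text \<open>
  Truncated subtraction makes the value at \<open>0\<close> equal to \<open>0\<close>, as a point of \<open>\<real>\<^sup>m\<close> requires.
\<close>

definition backward_diff :: "(nat \<Rightarrow> real) \<Rightarrow> nat \<Rightarrow> real" where
  "backward_diff y = (\<lambda>i. y (i - 1) - y i)"

lemma linear_backward_diff: "linear backward_diff"
  by (rule linearI) (auto simp: backward_diff_def scaleR_fun_def fun_eq_iff algebra_simps)

text \<open>
  Both sides vanish before position \<open>k\<close>. If \<open>k \<le> d\<close>, they equal \<open>-k\<close> at \<open>k\<close>, \<open>-1\<close> at the positions
  strictly between \<open>k\<close> and \<open>d + 1\<close>, and \<open>d\<close> at \<open>d + 1\<close>; for \<open>k = d + 1\<close> they are zero.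
\<close>

lemma point_of_one_at_minus_tau:
  assumes "1 \<le> k" "k \<le> Suc d"
  shows "point_of (one_at (Suc d) k) - point_of (tau (Suc d)) = backward_diff (lecture_hall_vertex d k)"
proof
  fix i
  show "(point_of (one_at (Suc d) k) - point_of (tau (Suc d))) i = backward_diff (lecture_hall_vertex d k) i"
    using assms
    by (auto simp: tau_eq_one_at point_of_one_at backward_diff_def lecture_hall_vertex_def)
qed

lemma translate_stack_triangle:
  "translate_neg (stack_triangle (Suc d)) (point_of (tau (Suc d))) =
    backward_diff ` lecture_hall_simplex d 1"
proof -
  let ?t = "point_of (tau (Suc d))"
  have one_le_Suc: "1 \<le> Suc d" by simp
  have "(\<lambda>x. x - ?t) = (\<lambda>x. - ?t + x)"
    by (simp add: fun_eq_iff)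
  then have "translate_neg (stack_triangle (Suc d)) ?t =
      convex hull ((\<lambda>x. - ?t + x) ` point_of ` one_at (Suc d) ` {1..Suc d})"
    by (simp only: translate_neg_def stack_triangle_def convex_hull_translation
        stack_sort_iterates_tau[OF one_le_Suc])
  also have "(\<lambda>x. - ?t + x) ` point_of ` one_at (Suc d) ` {1..Suc d} =
      backward_diff ` lecture_hall_vertex d ` {1..Suc d}"
    unfolding image_image by (intro image_cong) (simp_all flip: point_of_one_at_minus_tau)
  also have "convex hull \<dots> = backward_diff ` lecture_hall_simplex d 1"
    by (simp only: lecture_hall_simplex_eq_hull convex_hull_linear_image[OF linear_backward_diff])
  finally show ?thesis .
qed

definition lecture_hall_points :: "nat \<Rightarrow> real \<Rightarrow> (nat \<Rightarrow> real) set" where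
  "lecture_hall_points d lam = {y \<in> lecture_hall_simplex d lam. \<forall>i. y i \<in> \<int>}"

text \<open>
  The coordinates of \<open>y\<close> are negated partial sums of its backward differences, which is why
  integrality transfers back.
\<close>

lemma backward_diff_int_points_iff:
  assumes y: "y \<in> lecture_hall_simplex d lam"
  shows "backward_diff y \<in> int_points (Suc d) \<longleftrightarrow> (\<forall>i. y i \<in> \<int>)"
proof
  assume x: "backward_diff y \<in> int_points (Suc d)"
  have "y i \<in> \<int>" for i
  proof (induction i)
    case 0
    then show ?case using y by (simp add: lecture_hall_simplex_def)
  next
    case (Suc i)
    have "backward_diff y (Suc i) \<in> \<int>"
      using x unfolding int_points_def by (cases "Suc i \<in> {1..Suc d}") auto
    then have "y i - backward_diff y (Suc i) \<in> \<int>"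
      using Suc by (rule Ints_diff[rotated])
    then show ?case by (simp add: backward_diff_def)
  qed
  then show "\<forall>i. y i \<in> \<int>" by blast
next
  assume int: "\<forall>i. y i \<in> \<int>"
  have "backward_diff y i = 0" if "i \<notin> {1..Suc d}" for i
  proof -
    have "i - 1 \<notin> {1..d}" "i \<notin> {1..d}"
      using that by auto
    then have "y (i - 1) = 0" "y i = 0"
      using y unfolding lecture_hall_simplex_def by blast+
    then show ?thesis by (simp add: backward_diff_def)
  qed
  then show "backward_diff y \<in> int_points (Suc d)"
    using int by (auto simp: int_points_def backward_diff_def)
qed

lemma inj_on_backward_diff: "inj_on backward_diff {y. y 0 = 0}"
proof (rule inj_onI)
  fix y z :: "nat \<Rightarrow> real"
  assume yz: "y \<in> {y. y 0 = 0}" "z \<in> {y. y 0 = 0}" and eq: "backward_diff y = backward_diff z"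
  have "y i = z i" for i
  proof (induction i)
    case 0
    then show ?case using yz by simp
  next
    case (Suc i)
    then show ?case using fun_cong[OF eq, of "Suc i"] by (simp add: backward_diff_def)
  qed
  then show "y = z" by blast
qed

lemma L_real_stack_triangle:
  assumes "0 \<le> lam"
  shows "L_real (Suc d) (translate_neg (stack_triangle (Suc d)) (point_of (tau (Suc d)))) lam =
    card (lecture_hall_points d lam)"
proof -
  have "(\<lambda>x. lam *\<^sub>R x) ` backward_diff ` lecture_hall_simplex d 1 =
      backward_diff ` (\<lambda>y. lam *\<^sub>R y) ` lecture_hall_simplex d 1"
    by (simp add: image_image linear_cmul[OF linear_backward_diff])
  also have "\<dots> = backward_diff ` lecture_hall_simplex d lam"
    by (simp only: lecture_hall_simplex_scale[OF assms])
  also have "\<dots> \<inter> int_points (Suc d) = backward_diff ` lecture_hall_points d lam"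
    using backward_diff_int_points_iff by (auto simp: lecture_hall_points_def)
  finally have "L_real (Suc d) (translate_neg (stack_triangle (Suc d)) (point_of (tau (Suc d)))) lam
      = card (backward_diff ` lecture_hall_points d lam)"
    by (simp add: L_real_def translate_stack_triangle)
  also have "\<dots> = card (lecture_hall_points d lam)"
    by (intro card_image inj_on_subset[OF inj_on_backward_diff])
      (auto simp: lecture_hall_points_def lecture_hall_simplex_def)
  finally show ?thesis .
qed

section \<open>Slicing along the last coordinate\<close>

text \<open>
  Once the last coordinate is fixed to \<open>k\<close>, the last inequality of the chain becomes the upper bound
  \<open>k / (d + 1)\<close> on the ratio before it, and \<open>lam\<close> only limits the range of \<open>k\<close>.
\<close>

lemma lecture_hall_points_Suc:
  assumes "0 \<le> lam"
  shows "lecture_hall_points (Suc d) lam =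
    (\<Union>k\<in>{0..nat \<lfloor>real (Suc d) * lam\<rfloor>}.
       (\<lambda>y. y(Suc d := real k)) ` lecture_hall_points d (real k / real (Suc d)))"
    (is "_ = ?U")
proof (intro equalityI subsetI)
  fix y assume y: "y \<in> lecture_hall_points (Suc d) lam"
  then have simplex: "y \<in> lecture_hall_simplex (Suc d) lam" and int: "\<And>i. y i \<in> \<int>"
    by (auto simp: lecture_hall_points_def)
  have "y (Suc d) \<in> \<nat>"
    using int lecture_hall_nonneg[OF simplex] by (simp add: Nats_altdef2)
  then obtain k where k: "y (Suc d) = real k"
    by (auto elim: Nats_cases)
  have "real k / real (Suc d) \<le> lam"
    using simplex k by (simp add: lecture_hall_simplex_def)
  then have "real k \<le> real (Suc d) * lam"
    by (simp add: divide_le_eq mult.commute)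
  then have "k \<in> {0..nat \<lfloor>real (Suc d) * lam\<rfloor>}"
    by (simp add: le_nat_floor)
  moreover have "y(Suc d := 0) \<in> lecture_hall_points d (real k / real (Suc d))"
    using simplex int k
    by (auto simp: lecture_hall_points_def lecture_hall_simplex_def less_Suc_eq)
  moreover have "y = (y(Suc d := 0))(Suc d := real k)"
    using k by auto
  ultimately show "y \<in> ?U" by blast
next
  fix y assume "y \<in> ?U"
  then obtain k z where k: "k \<le> nat \<lfloor>real (Suc d) * lam\<rfloor>"
    and z: "z \<in> lecture_hall_points d (real k / real (Suc d))"
    and y: "y = z(Suc d := real k)"
    by auto
  have "real k \<le> real (Suc d) * lam"
    using k assms le_nat_iff[of "\<lfloor>real (Suc d) * lam\<rfloor>" k] by (simp add: le_floor_iff)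
  then have "real k / real (Suc d) \<le> lam"
    by (simp add: divide_le_eq mult.commute)
  then show "y \<in> lecture_hall_points (Suc d) lam"
    using z unfolding y
    by (auto simp: lecture_hall_points_def lecture_hall_simplex_def less_Suc_eq)
qed

lemma finite_lecture_hall_points:
  assumes "0 \<le> lam"
  shows "finite (lecture_hall_points d lam)"
  using assms
proof (induction d arbitrary: lam)
  case 0
  have "lecture_hall_points 0 lam \<subseteq> {0}"
    by (auto simp: lecture_hall_points_def lecture_hall_simplex_def)
  then show ?case by (rule finite_subset) simp
next
  case (Suc d)
  then show ?case by (simp add: lecture_hall_points_Suc)
qed

lemma card_lecture_hall_points_Suc:
  assumes "0 \<le> lam"
  shows "card (lecture_hall_points (Suc d) lam) =
    (\<Sum>k = 0..nat \<lfloor>real (Suc d) * lam\<rfloor>. card (lecture_hall_points d (real k / real (Suc d))))"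
proof -
  let ?slice = "\<lambda>k. (\<lambda>y. y(Suc d := real k)) ` lecture_hall_points d (real k / real (Suc d))"
  have card_slice: "card (?slice k) = card (lecture_hall_points d (real k / real (Suc d)))" for k
  proof (intro card_image inj_onI)
    fix y z
    assume mem: "y \<in> lecture_hall_points d (real k / real (Suc d))"
      "z \<in> lecture_hall_points d (real k / real (Suc d))"
      and eq: "y(Suc d := real k) = z(Suc d := real k)"
    have "y (Suc d) = z (Suc d)"
      using mem by (simp add: lecture_hall_points_def lecture_hall_simplex_def)
    then show "y = z"
      using eq by (metis fun_upd_triv fun_upd_upd)
  qed
  have disjoint: "?slice k \<inter> ?slice l = {}" if "k \<noteq> l" for k l
    using that by (auto dest: fun_cong[where x = "Suc d"])
  have "card (lecture_hall_points (Suc d) lam) =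
      (\<Sum>k = 0..nat \<lfloor>real (Suc d) * lam\<rfloor>. card (?slice k))"
    unfolding lecture_hall_points_Suc[OF assms]
    by (intro card_UN_disjoint) (use disjoint in \<open>auto intro!: finite_lecture_hall_points\<close>)
  then show ?thesis by (simp only: card_slice)
qed

section \<open>The recurrence for the lattice point counts\<close>

theorem theorem6p3:
  fixes n :: nat and lam :: real
  assumes "n \<ge> 2" and "lam \<ge> 0"
  shows "L_real (n + 1) (translate_neg (stack_triangle (n + 1)) (point_of (tau (n + 1)))) lam =
    (\<Sum>k = 0..nat \<lfloor>real n * lam\<rfloor>.
       L_real n (translate_neg (stack_triangle n) (point_of (tau n))) (real k / real n))"
proof -
  obtain d where n: "n = Suc d"
    using assms(1) by (cases n) auto
  have "L_real (n + 1) (translate_neg (stack_triangle (n + 1)) (point_of (tau (n + 1)))) lam =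
      card (lecture_hall_points n lam)"
    using L_real_stack_triangle[OF assms(2), of n] by simp
  also have "\<dots> = (\<Sum>k = 0..nat \<lfloor>real n * lam\<rfloor>. card (lecture_hall_points d (real k / real n)))"
    unfolding n by (rule card_lecture_hall_points_Suc[OF assms(2)])
  also have "\<dots> = (\<Sum>k = 0..nat \<lfloor>real n * lam\<rfloor>.
       L_real n (translate_neg (stack_triangle n) (point_of (tau n))) (real k / real n))"
    unfolding n by (intro sum.cong refl L_real_stack_triangle[symmetric]) simp
  finally show ?thesis .
qed

end
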